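(* Let $S$ be a semigroup which is finitely left divisible, cancellative and finitely generated. Let $E\subseteq\ell^\infty(S)$ be a Hopf algebra predual for $\ell^1(S)$. Then $E=c_0(S)$.
   Context: For a semigroup $S$ (discrete), $\ell^1(S)$ is the complex convolution Banach algebra with standard unit vectors $(\delta_s)_{s\in S}$ and product determined by $\delta_s\delta_t=\delta_{st}$; its dual is identified with $\ell^\infty(S)$, with bimodule actions $(\delta_s\cdot f)(t)=f(ts)$ and $(f\cdot\delta_s)(t)=f(st)$. A predual of a Banach algebra $A$ is a norm-closed sub-bimodule $E\subseteq A^*$ which is a Banach space predual of $A$, i.e. the canonical map $A\to E^*$, $a\mapsto(\mu\mapsto\mu(a))$, is a linear isomorphism (bijective and bicontinuous, not necessarily isometric). A Hopf algebra predual of $\ell^1(S)$ is a predual $E\subseteq\ell^\infty(S)$ which is also a subalgebra of $\ell^\infty(S)$ for the pointwise product. $S$ is cancellative if all left translations $t\mapsto st$ and right translations $t\mapsto ts$ are injective. $S$ is finitely left divisible if for each $s\in S$ the set $\{t\in S:\exists\, r\in S,\ tr=s\}$ is finite. $c_0(S)\subseteq\ell^\infty(S)$ is the space of functions vanishing at infinity on the discrete set $S$. *)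

theory Defs
  imports "HOL-Analysis.Analysis"
begin

text \<open>
  The semigroup is a type of class \<open>semigroup_mult\<close>.  Elements of \<open>\<ell>\<^sup>1(S)\<close> and \<open>\<ell>\<^sup>\<infinity>(S)\<close> are
  plain functions \<open>S \<Rightarrow> \<complex>\<close>, and the spaces are carrier sets of such functions.
\<close>

section \<open>Conditions on the semigroup\<close>

definition cancellative :: "'s::semigroup_mult itself \<Rightarrow> bool" where
  "cancellative _ \<longleftrightarrow>
     (\<forall>s::'s. inj (\<lambda>t. s * t)) \<and> (\<forall>s::'s. inj (\<lambda>t. t * s))"

definition finitely_left_divisible :: "'s::semigroup_mult itself \<Rightarrow> bool" where
  "finitely_left_divisible _ \<longleftrightarrow> (\<forall>s::'s. finite {t. \<exists>r. t * r = s})"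

definition subsemigroup :: "'s::semigroup_mult set \<Rightarrow> bool" where
  "subsemigroup T \<longleftrightarrow> (\<forall>s\<in>T. \<forall>t\<in>T. s * t \<in> T)"

definition finitely_generated :: "'s::semigroup_mult itself \<Rightarrow> bool" where
  "finitely_generated _ \<longleftrightarrow> (\<exists>X::'s set. finite X \<and> subsemigroup hull X = UNIV)"


section \<open>The spaces \<open>\<ell>\<^sup>1\<close>, \<open>\<ell>\<^sup>\<infinity>\<close> and \<open>c\<^sub>0\<close>\<close>

definition ell1 :: "('s \<Rightarrow> complex) set" where
  "ell1 = {a. (\<lambda>s. cmod (a s)) summable_on UNIV}"

definition ell1_norm :: "('s \<Rightarrow> complex) \<Rightarrow> real" where
  "ell1_norm a = (\<Sum>\<^sub>\<infinity>s. cmod (a s))"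

definition linf :: "('s \<Rightarrow> complex) set" where
  "linf = {f. bounded (range f)}"

definition linf_norm :: "('s \<Rightarrow> complex) \<Rightarrow> real" where
  "linf_norm f = (SUP s. cmod (f s))"

text \<open>Neighbourhoods of infinity in the discrete space \<open>S\<close> are the cofinite sets.\<close>

definition c0 :: "('s \<Rightarrow> complex) set" where
  "c0 = {f \<in> linf. (f \<longlongrightarrow> 0) cofinite}"

definition dirac :: "'s \<Rightarrow> 's \<Rightarrow> complex" where
  "dirac s = (\<lambda>t. if t = s then 1 else 0)"

definition pairing :: "('s \<Rightarrow> complex) \<Rightarrow> ('s \<Rightarrow> complex) \<Rightarrow> complex" where
  "pairing f a = (\<Sum>\<^sub>\<infinity>s. f s * a s)"


section \<open>Convolution and the bimodule actions on \<open>\<ell>\<^sup>\<infinity>\<close>\<close>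

definition conv ::
    "('s::semigroup_mult \<Rightarrow> complex) \<Rightarrow> ('s \<Rightarrow> complex) \<Rightarrow> 's \<Rightarrow> complex" where
  "conv a b = (\<lambda>u. \<Sum>\<^sub>\<infinity>(s, t)\<in>{(s, t). s * t = u}. a s * b t)"

text \<open>
  The actions of an arbitrary \<open>a = \<Sum>\<^sub>s a(s) \<delta>\<^sub>s\<close> in \<open>\<ell>\<^sup>1\<close>; the lemmas
  \<open>left_act_dirac\<close>, \<open>right_act_dirac\<close>, \<open>pairing_left_act\<close> and \<open>pairing_right_act\<close> below
  show that these are the dual actions.
\<close>

definition left_act ::
    "('s::semigroup_mult \<Rightarrow> complex) \<Rightarrow> ('s \<Rightarrow> complex) \<Rightarrow> 's \<Rightarrow> complex" where
  "left_act a f = (\<lambda>t. \<Sum>\<^sub>\<infinity>s. a s * f (t * s))"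

definition right_act ::
    "('s::semigroup_mult \<Rightarrow> complex) \<Rightarrow> ('s \<Rightarrow> complex) \<Rightarrow> 's \<Rightarrow> complex" where
  "right_act f a = (\<lambda>t. \<Sum>\<^sub>\<infinity>s. a s * f (s * t))"


section \<open>Preduals\<close>

definition complex_subspace :: "('s \<Rightarrow> complex) set \<Rightarrow> bool" where
  "complex_subspace E \<longleftrightarrow>
     (\<lambda>s. 0) \<in> E \<and>
     (\<forall>f\<in>E. \<forall>g\<in>E. (\<lambda>s. f s + g s) \<in> E) \<and>
     (\<forall>c. \<forall>f\<in>E. (\<lambda>s. c * f s) \<in> E)"

definition norm_closed :: "('s \<Rightarrow> complex) set \<Rightarrow> bool" where
  "norm_closed E \<longleftrightarrow>
     (\<forall>X f. (\<forall>n::nat. X n \<in> E) \<longrightarrow> f \<in> linf \<longrightarrow>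
        (\<lambda>n. linf_norm (\<lambda>s. X n s - f s)) \<longlonglongrightarrow> 0 \<longrightarrow> f \<in> E)"

definition sub_bimodule :: "('s::semigroup_mult \<Rightarrow> complex) set \<Rightarrow> bool" where
  "sub_bimodule E \<longleftrightarrow>
     E \<subseteq> linf \<and> complex_subspace E \<and>
     (\<forall>a\<in>ell1. \<forall>f\<in>E. left_act a f \<in> E \<and> right_act f a \<in> E)"

text \<open>
  The dual of \<open>E \<subseteq> \<ell>\<^sup>\<infinity>\<close>: bounded complex-linear functionals on \<open>E\<close>.  As \<open>E\<close> is a set and not a
  type, a functional is represented by the function that is \<open>undefined\<close> outside \<open>E\<close>, so that
  equality of functionals on \<open>E\<close> is equality of functions.
\<close>

definition dual :: "('s \<Rightarrow> complex) set \<Rightarrow> (('s \<Rightarrow> complex) \<Rightarrow> complex) set" where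
  "dual E = {\<phi> \<in> extensional E.
     (\<forall>f\<in>E. \<forall>g\<in>E. \<phi> (\<lambda>s. f s + g s) = \<phi> f + \<phi> g) \<and>
     (\<forall>c. \<forall>f\<in>E. \<phi> (\<lambda>s. c * f s) = c * \<phi> f) \<and>
     (\<exists>C. \<forall>f\<in>E. cmod (\<phi> f) \<le> C * linf_norm f)}"

definition dual_norm ::
    "('s \<Rightarrow> complex) set \<Rightarrow> (('s \<Rightarrow> complex) \<Rightarrow> complex) \<Rightarrow> real" where
  "dual_norm E \<phi> = (SUP f\<in>{f \<in> E. linf_norm f \<le> 1}. cmod (\<phi> f))"

definition canonical ::
    "('s \<Rightarrow> complex) set \<Rightarrow> ('s \<Rightarrow> complex) \<Rightarrow> ('s \<Rightarrow> complex) \<Rightarrow> complex" where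
  "canonical E a = (\<lambda>\<mu>\<in>E. pairing \<mu> a)"

text \<open>
  The canonical map is linear by construction, so continuity of the map and of its inverse
  amount to the two norm estimates.
\<close>

definition predual :: "('s::semigroup_mult \<Rightarrow> complex) set \<Rightarrow> bool" where
  "predual E \<longleftrightarrow>
     sub_bimodule E \<and> norm_closed E \<and>
     bij_betw (canonical E) ell1 (dual E) \<and>
     (\<exists>C. \<forall>a\<in>ell1. dual_norm E (canonical E a) \<le> C * ell1_norm a) \<and>
     (\<exists>C. \<forall>a\<in>ell1. ell1_norm a \<le> C * dual_norm E (canonical E a))"

definition hopf_algebra_predual :: "('s::semigroup_mult \<Rightarrow> complex) set \<Rightarrow> bool" where
  "hopf_algebra_predual E \<longleftrightarrow>
     predual E \<and> (\<forall>f\<in>E. \<forall>g\<in>E. (\<lambda>s. f s * g s) \<in> E)"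


section \<open>The actions are the dual actions\<close>

lemma dirac_in_ell1: "dirac s \<in> ell1"
proof -
  have "(\<lambda>t. norm (dirac s t)) summable_on {s}" by simp
  then have "(\<lambda>t. norm (dirac s t)) summable_on UNIV"
    by (rule summable_on_cong_neutral[THEN iffD1, rotated -1]) (auto simp: dirac_def)
  then show ?thesis by (simp add: ell1_def)
qed

lemma infsum_dirac: "(\<Sum>\<^sub>\<infinity>t. dirac s t * g t) = g s"
proof -
  have "(\<Sum>\<^sub>\<infinity>t. dirac s t * g t) = (\<Sum>\<^sub>\<infinity>t\<in>{s}. dirac s t * g t)"
    by (rule infsum_cong_neutral) (auto simp: dirac_def)
  then show ?thesis by (simp add: dirac_def)
qed

lemma left_act_dirac: "left_act (dirac s) f = (\<lambda>t. f (t * s))"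
  by (simp add: left_act_def infsum_dirac)

lemma right_act_dirac: "right_act f (dirac s) = (\<lambda>t. f (s * t))"
  by (simp add: right_act_def infsum_dirac)

lemma conv_dirac: "conv (dirac s) (dirac t) = dirac (s * t)"
proof
  fix u
  have "conv (dirac s) (dirac t) u =
      (\<Sum>\<^sub>\<infinity>(x, y)\<in>{(x, y). x * y = u} \<inter> {(s, t)}. dirac s x * dirac t y)"
    unfolding conv_def by (rule infsum_cong_neutral) (auto simp: dirac_def split: if_splits)
  also have "\<dots> = dirac (s * t) u"
    by (cases "s * t = u") (auto simp: dirac_def)
  finally show "conv (dirac s) (dirac t) u = dirac (s * t) u" .
qed

lemma summable_triple:
  fixes f :: "'s::semigroup_mult \<Rightarrow> complex"
  assumes "f \<in> linf" "a \<in> ell1" "b \<in> ell1"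
  shows "(\<lambda>(s, t). f (s * t) * (a s * b t)) summable_on UNIV \<times> UNIV"
proof -
  obtain C where C: "\<And>s. cmod (f s) \<le> C"
    using assms(1) by (auto simp: linf_def bounded_iff)
  have a: "(\<lambda>s. cmod (a s)) summable_on UNIV" and b: "(\<lambda>s. cmod (b s)) summable_on UNIV"
    using assms by (auto simp: ell1_def)
  have "(\<lambda>p. norm (case p of (s, t) \<Rightarrow> a s * b t)) summable_on UNIV \<times> UNIV"
    unfolding Infinite_Sum.abs_summable_on_Sigma_iff
    by (auto simp: norm_mult infsum_cmult_right' infsum_nonneg intro!: summable_on_cmult_right
        summable_on_cmult_left a b)
  then have "(\<lambda>p. C * norm (case p of (s, t) \<Rightarrow> a s * b t)) summable_on UNIV \<times> UNIV"
    by (rule summable_on_cmult_right)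
  then have "(\<lambda>p. norm (case p of (s, t) \<Rightarrow> f (s * t) * (a s * b t))) summable_on UNIV \<times> UNIV"
    by (rule Infinite_Sum.abs_summable_on_comparison_test')
      (auto simp: norm_mult intro!: mult_right_mono C)
  then show ?thesis by (rule Infinite_Sum.abs_summable_summable)
qed

lemma pairing_conv:
  assumes "f \<in> linf" "a \<in> ell1" "b \<in> ell1"
  shows "pairing f (conv a b) = (\<Sum>\<^sub>\<infinity>(s, t)\<in>UNIV \<times> UNIV. f (s * t) * (a s * b t))"
proof -
  let ?P = "\<lambda>u. {(s, t). s * t = u}"
  let ?h = "\<lambda>(s, t). (s * t, (s, t))"
  let ?F = "\<lambda>(u, (s, t)). f u * (a s * b t)"
  have bij: "bij_betw ?h (UNIV \<times> UNIV) (Sigma UNIV ?P)"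
    by (rule bij_betwI[where g = snd]) auto
  have "(\<lambda>p. ?F (?h p)) summable_on UNIV \<times> UNIV"
    using summable_triple[OF assms] by (simp add: case_prod_unfold)
  then have sm: "?F summable_on Sigma UNIV ?P"
    by (subst (asm) summable_on_reindex_bij_betw[OF bij])
  have "(\<Sum>\<^sub>\<infinity>(s, t)\<in>UNIV \<times> UNIV. f (s * t) * (a s * b t)) = (\<Sum>\<^sub>\<infinity>p\<in>UNIV \<times> UNIV. ?F (?h p))"
    by (simp add: case_prod_unfold)
  also have "\<dots> = infsum ?F (Sigma UNIV ?P)"
    by (rule infsum_reindex_bij_betw[OF bij])
  also have "\<dots> = (\<Sum>\<^sub>\<infinity>u. \<Sum>\<^sub>\<infinity>p\<in>?P u. ?F (u, p))"
    by (rule infsum_Sigma_banach[symmetric, OF sm])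
  also have "\<dots> = pairing f (conv a b)"
    by (simp add: pairing_def conv_def case_prod_unfold infsum_cmult_right')
  finally show ?thesis by simp
qed

lemma pairing_left_act:
  assumes "f \<in> linf" "a \<in> ell1" "b \<in> ell1"
  shows "pairing (left_act a f) b = pairing f (conv b a)"
proof -
  have "pairing f (conv b a) = (\<Sum>\<^sub>\<infinity>t. \<Sum>\<^sub>\<infinity>s. f (t * s) * (b t * a s))"
    unfolding pairing_conv[OF assms(1,3,2)]
    using infsum_Sigma_banach[OF summable_triple[OF assms(1,3,2)]] by simp
  also have "\<dots> = (\<Sum>\<^sub>\<infinity>t. (\<Sum>\<^sub>\<infinity>s. a s * f (t * s)) * b t)"
    by (simp only: infsum_cmult_left'[symmetric]) (simp add: mult_ac)
  finally show ?thesis by (simp add: pairing_def left_act_def)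
qed

lemma pairing_right_act:
  assumes "f \<in> linf" "a \<in> ell1" "b \<in> ell1"
  shows "pairing (right_act f a) b = pairing f (conv a b)"
proof -
  have "pairing f (conv a b) = (\<Sum>\<^sub>\<infinity>s. \<Sum>\<^sub>\<infinity>t. f (s * t) * (a s * b t))"
    unfolding pairing_conv[OF assms]
    using infsum_Sigma_banach[OF summable_triple[OF assms]] by simp
  also have "\<dots> = (\<Sum>\<^sub>\<infinity>t. \<Sum>\<^sub>\<infinity>s. f (s * t) * (a s * b t))"
    by (rule infsum_swap_banach) (rule summable_triple[OF assms])
  also have "\<dots> = (\<Sum>\<^sub>\<infinity>t. (\<Sum>\<^sub>\<infinity>s. a s * f (s * t)) * b t)"
    by (simp only: infsum_cmult_left'[symmetric]) (simp add: mult_ac)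
  finally show ?thesis by (simp add: pairing_def right_act_def)
qed

end

theory Submission
  imports Defs
begin

text \<open>
  If the evaluations \<open>\<delta>\<^sub>s\<close> converge pointwise on \<open>E\<close> along a filter, then the limit is a bounded
  functional, hence given by some \<open>a\<close> in \<open>\<ell>\<^sup>1(S)\<close>, and it is multiplicative because \<open>E\<close> is an
  algebra.  Multiplicativity forces \<open>a(s) g(s) = \<langle>a, g\<rangle> a(s)\<close> for all \<open>g\<close> in \<open>E\<close>, so \<open>a\<close> is \<open>0\<close> or
  some \<open>\<delta>\<^sub>u\<close>.

  The second alternative does not occur along a free filter.  Let \<open>D\<close> be the finite set of left
  divisors of \<open>u\<close> and \<open>W\<close> the finite set of elements at which a product of generators, read from
  left to right, first leaves \<open>D\<close>.  Then \<open>S = D \<union> W \<union> W S\<close>, so the filter meets some \<open>w S\<close>; since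
  translation by \<open>w\<close> is continuous, the limit is \<open>0\<close> or \<open>\<delta>\<^bsub>wv\<^esub>\<close>, and \<open>u\<close> would be a multiple of
  \<open>w\<close>.  As bounded families have limits along finer filters, \<open>E \<subseteq> c\<^sub>0(S)\<close>.

  Conversely, \<open>E\<close> separates points, so for finite \<open>F\<close> without \<open>s\<close> it contains \<open>k\<close> with \<open>k(s) = 1\<close>
  and \<open>k = 0\<close> on \<open>F\<close>.  If \<open>h\<close> in \<open>E \<subseteq> c\<^sub>0(S)\<close> has \<open>h(s) = 1\<close> and \<open>F\<close> is the set of \<open>t \<noteq> s\<close> with
  \<open>\<bar>h(t)\<bar> \<ge> 1/2\<close>, then \<open>k h\<^sup>n \<rightarrow> \<delta>\<^sub>s\<close> uniformly, so \<open>E\<close> contains all \<open>\<delta>\<^sub>s\<close>.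
\<close>

section \<open>Compactness and limits along finer filters\<close>

lemma subfilter_pointwise_limit:
  fixes F :: "'s filter" and E :: "('s \<Rightarrow> complex) set"
  assumes "F \<noteq> bot" and bdd: "\<And>f. f \<in> E \<Longrightarrow> bounded (range f)"
  obtains G \<phi> where "G \<le> F" "G \<noteq> bot" "\<And>f. f \<in> E \<Longrightarrow> (f \<longlongrightarrow> \<phi> f) G"
proof -
  \<comment> \<open>The value 0 off \<open>E\<close> makes every coordinate bounded, so that
    Tychonoff's theorem applies to the product over all functions.\<close>
  define e where "e = (\<lambda>s (f :: 's \<Rightarrow> complex). if f \<in> E then f s else 0)"
  define K where "K = PiE UNIV (\<lambda>f. closure (range (\<lambda>s. e s f)))"
  have "compact (closure (range (\<lambda>s. e s f)))" for f
    using bdd by (auto simp: e_def)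
  then have "compactin (product_topology (\<lambda>_. euclidean) UNIV) K"
    unfolding K_def compactin_PiE by simp
  then have K: "compact K"
    by (simp add: euclidean_product_topology)
  have eK: "e s \<in> K" for s
    unfolding K_def by (auto intro!: subsetD[OF closure_subset])
  then have "eventually (\<lambda>x. x \<in> K) (filtermap e F)"
    by (simp add: eventually_filtermap)
  moreover have "filtermap e F \<noteq> bot"
    using assms(1) by (simp add: filtermap_bot_iff)
  ultimately obtain \<phi> where \<phi>: "inf (nhds \<phi>) (filtermap e F) \<noteq> bot"
    using K unfolding compact_filter by blast
  \<comment> \<open>\<open>F\<close> is refined by the preimages of the neighbourhoods of the
    cluster point \<open>\<phi>\<close>; clustering means exactly that none of them misses
    \<open>F\<close>.\<close>
  define G where "G = inf F (filtercomap e (nhds \<phi>))"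
  have "G \<noteq> bot"
  proof
    assume "G = bot"
    then have "eventually (\<lambda>_. False) G"
      by simp
    then obtain P R where P: "eventually P F" and R: "eventually R (nhds \<phi>)"
      and PR: "\<And>x. P x \<Longrightarrow> R (e x) \<Longrightarrow> False"
      unfolding G_def eventually_inf eventually_filtercomap by metis
    have "eventually (\<lambda>y. \<not> R y) (filtermap e F)"
      unfolding eventually_filtermap using P by eventually_elim (use PR in blast)
    with R have "eventually (\<lambda>_. False) (inf (nhds \<phi>) (filtermap e F))"
      unfolding eventually_inf by blast
    with \<phi> show False
      by (simp add: trivial_limit_def)
  qed
  moreover have "(f \<longlongrightarrow> \<phi> f) G" if "f \<in> E" for f
  proof -
    have "filterlim e (nhds \<phi>) G"
      unfolding G_def by (meson filterlim_filtercomap filterlim_mono inf.cobounded2 order_refl)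
    moreover have "((\<lambda>\<psi>. \<psi> f) \<longlongrightarrow> \<phi> f) (nhds \<phi>)"
    proof (rule topological_tendstoI)
      fix U assume "open U" "\<phi> f \<in> U"
      moreover have "open ((\<lambda>\<psi>. \<psi> f) -` U)"
        by (rule open_vimage[OF \<open>open U\<close> continuous_on_product_coordinates])
      ultimately show "\<forall>\<^sub>F \<psi> in nhds \<phi>. \<psi> f \<in> U"
        using eventually_nhds_in_open[of "(\<lambda>\<psi>. \<psi> f) -` U" \<phi>] by simp
    qed
    ultimately have "((\<lambda>s. e s f) \<longlongrightarrow> \<phi> f) G"
      by (rule filterlim_compose[rotated])
    then show ?thesis
      using that by (simp add: e_def)
  qed
  ultimately show ?thesis
    using that[of G \<phi>] by (simp add: G_def)
qed

text \<open>The right-hand side contains the generators and absorbs right multiplication by them: a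
  product \<open>d * x\<close> either stays in \<open>D\<close> or lands in
  \<open>W\<close>.\<close>

lemma finitely_generated_decomposition:
  fixes D :: "'s::semigroup_mult set"
  assumes "finitely_generated TYPE('s)" "finite D"
  obtains W where "finite W" "W \<inter> D = {}" "UNIV = D \<union> W \<union> (\<Union>w\<in>W. range ((*) w))"
proof -
  obtain X :: "'s set" where X: "finite X" "subsemigroup hull X = UNIV"
    using assms(1) by (auto simp: finitely_generated_def)
  define W where "W = (X \<union> (\<lambda>(d, x). d * x) ` (D \<times> X)) - D"
  define T where "T = D \<union> W \<union> (\<Union>w\<in>W. range ((*) w))"
  have XT: "X \<subseteq> T"
    by (auto simp: T_def W_def)
  have right: "t * y \<in> T" if "t \<in> T" for t y
  proof -
    \<comment> \<open>The right multipliers of \<open>T\<close> form a subsemigroup, so only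
      generators have to be tested.\<close>
    have "subsemigroup hull X \<subseteq> {y. \<forall>t\<in>T. t * y \<in> T}"
    proof (rule hull_minimal)
      have "t * x \<in> T" if "x \<in> X" "t \<in> T" for x t
      proof -
        consider "t \<in> D" | "t \<in> W" | w r where "w \<in> W" "t = w * r"
          using \<open>t \<in> T\<close> by (auto simp: T_def)
        then show ?thesis
        proof cases
          case 1
          with \<open>x \<in> X\<close> show ?thesis
            by (force simp: T_def W_def)
        qed (auto simp: T_def mult.assoc)
      qed
      then show "X \<subseteq> {y. \<forall>t\<in>T. t * y \<in> T}"
        by blast
    qed (auto simp: subsemigroup_def mult.assoc[symmetric])
    with X that show ?thesis
      by blast
  qed
  have "subsemigroup hull X \<subseteq> T"
    by (rule hull_minimal[OF XT]) (auto simp: subsemigroup_def right)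
  then have "UNIV = T"
    using X by auto
  moreover have "finite W" "W \<inter> D = {}"
    using X assms by (auto simp: W_def)
  ultimately show ?thesis
    using that by (simp add: T_def)
qed

section \<open>Estimates in \<open>ell1\<close>, \<open>linf\<close> and \<open>c0\<close>\<close>

lemma cmod_le_linf_norm: "f \<in> linf \<Longrightarrow> cmod (f s) \<le> linf_norm f"
  unfolding linf_norm_def linf_def
  by (rule cSUP_upper) (auto simp: bounded_iff bdd_above_def)

lemma linf_norm_tendsto_0:
  assumes "\<And>n s. cmod (X n s) \<le> B n" "B \<longlonglongrightarrow> 0"
  shows "(\<lambda>n. linf_norm (X n)) \<longlonglongrightarrow> 0"
proof (rule tendsto_sandwich[OF _ _ tendsto_const assms(2)])
  \<comment> \<open>The bound \<open>B n\<close> puts \<open>X n\<close> in \<open>linf\<close>,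
    where the real supremum is meaningful.\<close>
  have "0 \<le> linf_norm (X n)" for n
  proof -
    have "X n \<in> linf"
      using assms(1) by (auto simp: linf_def bounded_iff)
    then show ?thesis
      by (rule order_trans[OF norm_ge_zero cmod_le_linf_norm])
  qed
  then show "\<forall>\<^sub>F n in sequentially. 0 \<le> linf_norm (X n)"
    by simp
  show "\<forall>\<^sub>F n in sequentially. linf_norm (X n) \<le> B n"
    unfolding linf_norm_def by (auto intro!: always_eventually cSUP_least assms(1))
qed

lemma ell1_mult_linf:
  assumes "a \<in> ell1" "g \<in> linf"
  shows "(\<lambda>s. a s * g s) \<in> ell1"
proof -
  obtain C where C: "\<And>s. cmod (g s) \<le> C"
    using assms(2) by (auto simp: linf_def bounded_iff)
  have "(\<lambda>s. cmod (a s) * C) summable_on UNIV"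
    using assms(1) by (auto simp: ell1_def intro: summable_on_cmult_left)
  then have "(\<lambda>s. cmod (a s * g s)) summable_on UNIV"
    by (rule Infinite_Sum.abs_summable_on_comparison_test')
      (auto simp: norm_mult intro: mult_left_mono C)
  then show ?thesis
    by (simp add: ell1_def)
qed

lemma pairing_dirac: "pairing f (dirac s) = f s"
  unfolding pairing_def by (subst mult.commute) (rule infsum_dirac)

lemma c0_finite:
  assumes "f \<in> c0" "\<epsilon> > 0"
  shows "finite {s. \<epsilon> \<le> cmod (f s)}"
proof -
  have "\<forall>\<^sub>F s in cofinite. dist (f s) 0 < \<epsilon>"
    using assms tendstoD unfolding c0_def by blast
  then show ?thesis
    by (simp add: eventually_cofinite not_less)
qed

section \<open>Separation properties of a Hopf algebra predual\<close>

locale hopf_predual =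
  fixes E :: "('s::semigroup_mult \<Rightarrow> complex) set"
  assumes hopf: "hopf_algebra_predual E"
begin

lemma subset_linf: "E \<subseteq> linf"
  and subspace: "complex_subspace E"
  and closed: "norm_closed E"
  and canonical_bij: "bij_betw (canonical E) ell1 (dual E)"
  and mult: "\<And>f g. f \<in> E \<Longrightarrow> g \<in> E \<Longrightarrow> (\<lambda>s. f s * g s) \<in> E"
  and right_act: "\<And>a f. a \<in> ell1 \<Longrightarrow> f \<in> E \<Longrightarrow> right_act f a \<in> E"
  using hopf by (auto simp: hopf_algebra_predual_def predual_def sub_bimodule_def)

lemma add: "f \<in> E \<Longrightarrow> g \<in> E \<Longrightarrow> (\<lambda>s. f s + g s) \<in> E"
  and cmult: "f \<in> E \<Longrightarrow> (\<lambda>s. c * f s) \<in> E"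
  and zero: "(\<lambda>s. 0) \<in> E"
  using subspace by (auto simp: complex_subspace_def)

lemma left_translate:
  assumes "f \<in> E"
  shows "(\<lambda>t. f (w * t)) \<in> E"
  using right_act[OF dirac_in_ell1 assms, of w] by (simp add: right_act_dirac)

text \<open>This is injectivity of the canonical map; identities in \<open>ell1\<close> are proved
  by testing against \<open>E\<close>.\<close>

lemma ell1_eqI:
  assumes "a \<in> ell1" "b \<in> ell1" "\<And>f. f \<in> E \<Longrightarrow> pairing f a = pairing f b"
  shows "a = b"
proof -
  have "canonical E a = canonical E b"
    unfolding canonical_def using assms(3) by (auto intro: restrict_ext)
  then show ?thesis
    using canonical_bij assms by (auto simp: bij_betw_def inj_on_def)
qed

lemma separates_points:
  assumes "\<And>f. f \<in> E \<Longrightarrow> f s = f t"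
  shows "s = t"
proof -
  have "dirac s = dirac t"
    by (rule ell1_eqI) (auto simp: dirac_in_ell1 pairing_dirac assms)
  then have "dirac s s = dirac t s"
    by simp
  then show ?thesis
    by (auto simp: dirac_def split: if_splits)
qed

lemma exists_one:
  obtains h where "h \<in> E" "h s = 1"
proof -
  have "\<exists>f\<in>E. f s \<noteq> 0"
  proof (rule ccontr)
    assume "\<not> ?thesis"
    then have "dirac s = (\<lambda>s. 0)"
      by (intro ell1_eqI) (auto simp: dirac_in_ell1 pairing_dirac, simp_all add: ell1_def pairing_def)
    then show False
      by (metis dirac_def zero_neq_one)
  qed
  then obtain f where "f \<in> E" "f s \<noteq> 0"
    by blast
  then show ?thesis
    using that[OF cmult[of f "1 / f s"]] by simp
qed

lemma exists_one_zero:
  assumes "s \<noteq> t"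
  obtains g where "g \<in> E" "g s = 1" "g t = 0"
proof -
  obtain h where h: "h \<in> E" "h s = 1"
    by (rule exists_one)
  obtain f where f: "f \<in> E" "f s \<noteq> f t"
    using assms separates_points by blast
  \<comment> \<open>The natural choice \<open>f - f t\<close> would need constants in
    \<open>E\<close>; multiplying by \<open>h\<close> replaces the constant by
    \<open>f t * h\<close>.\<close>
  have "(\<lambda>x. 1 / (f s - f t) * (f x * h x + - f t * h x)) \<in> E"
    by (intro cmult add mult f h)
  then show ?thesis
    using that h f by fastforce
qed

section \<open>Limits of point evaluations\<close>

lemma limit_cases:
  assumes "G \<noteq> bot" and lim: "\<And>f. f \<in> E \<Longrightarrow> (f \<longlongrightarrow> \<phi> f) G"
  shows "(\<forall>f\<in>E. \<phi> f = 0) \<or> (\<exists>u. \<forall>f\<in>E. \<phi> f = f u)"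
proof -
  have uniq: "\<phi> f = c" if "f \<in> E" "(f \<longlongrightarrow> c) G" for f c
    using tendsto_unique[OF assms(1)] lim that by blast
  have "restrict \<phi> E \<in> dual E"
    unfolding dual_def
  proof (intro CollectI conjI ballI allI exI[of _ 1])
    fix f assume f: "f \<in> E"
    have "cmod (\<phi> f) \<le> linf_norm f"
      by (rule tendsto_upperbound[OF tendsto_norm[OF lim[OF f]]])
        (use f subset_linf assms(1) in \<open>auto simp: cmod_le_linf_norm subset_iff\<close>)
    then show "cmod (restrict \<phi> E f) \<le> 1 * linf_norm f"
      using f by simp
    show "restrict \<phi> E (\<lambda>s. c * f s) = c * restrict \<phi> E f" for c
      using f cmult by (auto intro!: uniq tendsto_mult_left lim)
    fix g assume g: "g \<in> E"
    show "restrict \<phi> E (\<lambda>s. f s + g s) = restrict \<phi> E f + restrict \<phi> E g"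
      using f g add by (auto intro!: uniq tendsto_add lim)
  qed auto
  then obtain a where a: "a \<in> ell1" "canonical E a = restrict \<phi> E"
    using canonical_bij by (metis bij_betw_imp_surj_on imageE)
  have pair: "\<phi> f = pairing f a" if "f \<in> E" for f
    using fun_cong[OF a(2), of f] that by (simp add: canonical_def)
  have eigen: "a s * g s = \<phi> g * a s" if g: "g \<in> E" for g s
  proof -
    have "(\<lambda>s. a s * g s) = (\<lambda>s. \<phi> g * a s)"
    proof (rule ell1_eqI)
      show "(\<lambda>s. a s * g s) \<in> ell1"
        using a g subset_linf by (auto intro: ell1_mult_linf)
      have "(\<lambda>s. a s * \<phi> g) \<in> ell1"
        using a(1) by (rule ell1_mult_linf) (simp add: linf_def)
      then show "(\<lambda>s. \<phi> g * a s) \<in> ell1"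
        by (simp add: mult.commute)
      fix f assume f: "f \<in> E"
      have "pairing f (\<lambda>s. a s * g s) = pairing (\<lambda>s. f s * g s) a"
        by (simp add: pairing_def mult_ac)
      \<comment> \<open>Limits of products are products of limits, so \<open>\<phi>\<close> is
        multiplicative.\<close>
      also have "\<dots> = \<phi> f * \<phi> g"
        unfolding pair[OF mult[OF f g], symmetric]
        by (intro uniq mult tendsto_mult lim f g)
      also have "\<dots> = \<phi> g * (\<Sum>\<^sub>\<infinity>s. f s * a s)"
        using pair[OF f] by (simp add: pairing_def)
      also have "\<dots> = pairing f (\<lambda>s. \<phi> g * a s)"
        unfolding pairing_def infsum_cmult_right'[symmetric] by (simp add: mult_ac)
      finally show "pairing f (\<lambda>s. a s * g s) = pairing f (\<lambda>s. \<phi> g * a s)" .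
    qed
    then show ?thesis
      by meson
  qed
  show ?thesis
  proof (cases "\<exists>u. a u \<noteq> 0")
    \<comment> \<open>At a point \<open>u\<close> with \<open>a u \<noteq> 0\<close>, cancelling
      \<open>a u\<close> in \<open>eigen\<close> gives \<open>\<phi> g = g u\<close>.\<close>
    case True
    then show ?thesis
      using eigen by (metis mult.commute mult_right_cancel)
  next
    case False
    then show ?thesis
      using pair by (simp add: pairing_def)
  qed
qed

lemma exists_subfilter_limit:
  assumes "F \<noteq> bot"
  obtains (zero) G where "G \<le> F" "G \<noteq> bot" "\<And>f. f \<in> E \<Longrightarrow> (f \<longlongrightarrow> 0) G"
    | (point) G u where "G \<le> F" "G \<noteq> bot" "\<And>f. f \<in> E \<Longrightarrow> (f \<longlongrightarrow> f u) G"
proof -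
  have "bounded (range f)" if "f \<in> E" for f
    using that subset_linf by (auto simp: linf_def)
  then obtain G \<phi> where G: "G \<le> F" "G \<noteq> bot" and lim: "\<And>f. f \<in> E \<Longrightarrow> (f \<longlongrightarrow> \<phi> f) G"
    by (rule subfilter_pointwise_limit[OF assms]) (assumption | rule that)+
  have "(\<forall>f\<in>E. \<phi> f = 0) \<or> (\<exists>u. \<forall>f\<in>E. \<phi> f = f u)"
    by (rule limit_cases[OF G(2) lim])
  then show ?thesis
  proof (elim disjE exE)
    assume "\<forall>f\<in>E. \<phi> f = 0"
    then show ?thesis
      using lim by (intro zero[OF G]) simp
  next
    fix u assume "\<forall>f\<in>E. \<phi> f = f u"
    then show ?thesis
      using lim by (intro point[OF G]) simp
  qed
qed

lemma limit_in_principal_right_ideal: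
  assumes G: "G \<le> principal (range ((*) w))" "G \<noteq> bot" and lim: "\<And>f. f \<in> E \<Longrightarrow> (f \<longlongrightarrow> f u) G"
  shows "u \<in> range ((*) w)"
proof -
  \<comment> \<open>Pulling back along translation keeps the filter proper because \<open>G\<close>
    lives on the image.\<close>
  have "filtercomap ((*) w) G \<noteq> bot"
  proof (rule filtercomap_neq_bot)
    fix P assume "eventually P G"
    moreover have "eventually (\<lambda>x. x \<in> range ((*) w)) G"
      using G(1) by (simp add: le_principal)
    ultimately have "eventually (\<lambda>x. P x \<and> x \<in> range ((*) w)) G"
      by eventually_elim simp
    then show "\<exists>x. P (w * x)"
      using eventually_happens'[OF G(2)] by blast
  qed
  moreover have limw: "((\<lambda>t. f (w * t)) \<longlongrightarrow> f u) H"
    if "f \<in> E" "H \<le> filtercomap ((*) w) G" for f H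
    by (rule filterlim_compose[OF lim[OF that(1)]])
      (use that(2) in \<open>meson filterlim_filtercomap filterlim_mono order_refl\<close>)
  \<comment> \<open>The dichotomy is applied to the pulled-back filter: a translate of
    \<open>f\<close> again lies in \<open>E\<close>, so its limit \<open>f u\<close> is 0 for all
    \<open>f\<close> or \<open>f (w * v)\<close> for all \<open>f\<close>.\<close>
  ultimately show ?thesis
  proof (cases rule: exists_subfilter_limit)
    case (zero H)
    obtain h where h: "h \<in> E" "h u = 1"
      by (rule exists_one)
    have "h u = 0"
      using tendsto_unique[OF zero(2) limw[OF h(1) zero(1)] zero(3)[OF left_translate[OF h(1)]]] .
    with h show ?thesis
      by simp
  next
    case (point H v)
    have "f u = f (w * v)" if "f \<in> E" for f
      using tendsto_unique[OF point(2) limw[OF that point(1)] point(3)[OF left_translate[OF that]]] .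
    then show ?thesis
      using separates_points[of u "w * v"] by blast
  qed
qed

lemma free_limit:
  assumes fin: "finitely_left_divisible TYPE('s)" "finitely_generated TYPE('s)"
    and G: "G \<le> cofinite" "G \<noteq> bot" and lim: "\<And>f. f \<in> E \<Longrightarrow> (f \<longlongrightarrow> f u) G"
  shows False
proof -
  define D where "D = {t. \<exists>r. t * r = u}"
  have "finite D"
    using fin(1) by (simp add: finitely_left_divisible_def D_def)
  then obtain W where W: "finite W" "W \<inter> D = {}" "UNIV = D \<union> W \<union> (\<Union>w\<in>W. range ((*) w))"
    using finitely_generated_decomposition[OF fin(2)] by blast
  \<comment> \<open>Otherwise \<open>G\<close> would avoid all of the finitely many sets
    \<open>w S\<close> and live on the finite set \<open>D \<union> W\<close>.\<close>
  have "\<exists>w\<in>W. inf G (principal (range ((*) w))) \<noteq> bot"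
  proof (rule ccontr)
    assume "\<not> ?thesis"
    then have "\<forall>w\<in>W. eventually (\<lambda>x. x \<notin> range ((*) w)) G"
      by (simp add: trivial_limit_def eventually_inf_principal)
    then have "eventually (\<lambda>x. \<forall>w\<in>W. x \<notin> range ((*) w)) G"
      using W(1) by (simp add: eventually_ball_finite)
    moreover have "eventually (\<lambda>x. x \<notin> D \<union> W) G"
      using filter_leD[OF G(1), of "\<lambda>x. x \<notin> D \<union> W"] \<open>finite D\<close> W(1)
      by (simp add: eventually_cofinite)
    ultimately have "eventually (\<lambda>x. False) G"
      by eventually_elim (use W(3) in blast)
    with G(2) show False
      by (simp add: trivial_limit_def)
  qed
  then obtain w where w: "w \<in> W" "inf G (principal (range ((*) w))) \<noteq> bot"
    by blast
  have "u \<in> range ((*) w)"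
    by (rule limit_in_principal_right_ideal[OF _ w(2)])
      (auto intro: tendsto_mono[OF _ lim])
  then have "w \<in> D"
    by (auto simp: D_def)
  with w W show False
    by blast
qed

section \<open>The two inclusions\<close>

lemma subset_c0:
  assumes "finitely_left_divisible TYPE('s)" "finitely_generated TYPE('s)"
  shows "E \<subseteq> c0"
proof
  fix f assume f: "f \<in> E"
  have "(f \<longlongrightarrow> 0) cofinite"
  proof (rule ccontr)
    assume "\<not> ?thesis"
    then obtain \<epsilon> where \<epsilon>: "\<epsilon> > 0" "\<not> (\<forall>\<^sub>F s in cofinite. dist (f s) 0 < \<epsilon>)"
      unfolding tendsto_iff by blast
    define A where "A = {s. \<not> dist (f s) 0 < \<epsilon>}"
    \<comment> \<open>\<open>A\<close> is infinite, so this filter is proper. A zero limit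
      contradicts the lower bound \<open>\<epsilon>\<close> on \<open>A\<close>, and a point limit
      contradicts \<open>free_limit\<close>.\<close>
    have "inf cofinite (principal A) \<noteq> bot"
      using \<epsilon>(2) by (simp add: trivial_limit_def eventually_inf_principal A_def)
    then show False
    proof (cases rule: exists_subfilter_limit)
      case (zero G)
      have "eventually (\<lambda>s. s \<in> A) G"
        using zero(1) by (simp add: le_principal)
      moreover have "eventually (\<lambda>s. dist (f s) 0 < \<epsilon>) G"
        using tendstoD[OF zero(3)[OF f] \<epsilon>(1)] .
      ultimately have "eventually (\<lambda>s. False) G"
        by eventually_elim (simp add: A_def)
      with zero(2) show False
        by (simp add: trivial_limit_def)
    next
      case (point G u)
      then show False
        using free_limit[OF assms] by auto
    qed
  qed
  then show "f \<in> c0"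
    using f subset_linf by (auto simp: c0_def)
qed

lemma exists_vanishing_on_finite:
  assumes "finite F" "s \<notin> F"
  obtains k where "k \<in> E" "k s = 1" "\<And>t. t \<in> F \<Longrightarrow> k t = 0"
proof -
  have "\<exists>k\<in>E. k s = 1 \<and> (\<forall>t\<in>F. k t = 0)"
    using assms
  proof (induction F)
    case empty
    then show ?case
      using exists_one[of s] by auto
  next
    case (insert t F)
    then obtain k where k: "k \<in> E" "k s = 1" "\<forall>t\<in>F. k t = 0"
      by auto
    obtain g where g: "g \<in> E" "g s = 1" "g t = 0"
      using exists_one_zero[of s t] insert by auto
    show ?case
      using mult[OF k(1) g(1)] k g by (intro bexI[of _ "\<lambda>x. k x * g x"]) auto
  qed
  then show ?thesis
    using that by blast
qed

lemma dirac_mem: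
  assumes "E \<subseteq> c0"
  shows "dirac s \<in> E"
proof -
  obtain h where h: "h \<in> E" "h s = 1"
    by (rule exists_one)
  \<comment> \<open>These are the finitely many points other than \<open>s\<close> where powers of
    \<open>h\<close> need not become small; \<open>k\<close> removes them.\<close>
  define F where "F = {t. 1 / 2 \<le> cmod (h t)} - {s}"
  have "finite F" "s \<notin> F"
    using assms h c0_finite[of h "1 / 2"] by (auto simp: F_def)
  then obtain k where k: "k \<in> E" "k s = 1" "\<And>t. t \<in> F \<Longrightarrow> k t = 0"
    by (rule exists_vanishing_on_finite) blast
  define X where "X = (\<lambda>n t. k t * h t ^ n)"
  have "X n \<in> E" for n
  proof (induction n)
    case 0
    \<comment> \<open>\<open>X 0\<close> is \<open>k\<close> itself; the factor \<open>k\<close>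
      keeps the sequence in \<open>E\<close> although \<open>h ^ 0\<close> is the constant
      1.\<close>
    show ?case
      using k by (simp add: X_def)
  next
    case (Suc n)
    have "X (Suc n) = (\<lambda>t. X n t * h t)"
      by (simp add: X_def mult_ac)
    then show ?case
      using mult[OF Suc h(1)] by simp
  qed
  moreover have "(\<lambda>n. linf_norm (\<lambda>t. X n t - dirac s t)) \<longlonglongrightarrow> 0"
  proof (rule linf_norm_tendsto_0)
    show "(\<lambda>n. linf_norm k * (1 / 2) ^ n) \<longlonglongrightarrow> 0"
      by (intro tendsto_mult_right_zero LIMSEQ_power_zero) simp
    fix n t
    have kn: "cmod (k t) \<le> linf_norm k"
      using k(1) subset_linf by (auto intro: cmod_le_linf_norm)
    then have nn: "0 \<le> linf_norm k"
      by (rule order_trans[OF norm_ge_zero])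
    consider "t = s" | "t \<in> F" | "t \<noteq> s" "cmod (h t) \<le> 1 / 2"
      by (force simp: F_def)
    then show "cmod (X n t - dirac s t) \<le> linf_norm k * (1 / 2) ^ n"
    proof cases
      \<comment> \<open>Only here is the difference possibly nonzero, and the powers of
        \<open>h\<close> decay geometrically.\<close>
      case 3
      have "cmod (k t) * cmod (h t) ^ n \<le> linf_norm k * (1 / 2) ^ n"
        using 3 kn nn by (intro mult_mono power_mono) auto
      then show ?thesis
        using 3 by (simp add: X_def dirac_def norm_mult norm_power)
    qed (use h k nn \<open>s \<notin> F\<close> in \<open>auto simp: X_def dirac_def\<close>)
  qed
  moreover have "dirac s \<in> linf"
    by (auto simp: linf_def bounded_iff dirac_def)
  ultimately show ?thesis
    using closed unfolding norm_closed_def by blast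
qed

lemma c0_subset:
  assumes "E \<subseteq> c0"
  shows "c0 \<subseteq> E"
proof
  fix f :: "'s \<Rightarrow> complex" assume f: "f \<in> c0"
  have finsum: "(\<lambda>t. \<Sum>s\<in>A. f s * dirac s t) \<in> E" if "finite A" for A
    using that by (induction A) (auto intro!: zero add cmult dirac_mem assms)
  \<comment> \<open>Truncating \<open>f\<close> to the finite set \<open>A n\<close> leaves a
    uniform error of at most \<open>1 / Suc n\<close>.\<close>
  define A where "A = (\<lambda>n. {s. 1 / real (Suc n) \<le> cmod (f s)})"
  have finA: "finite (A n)" for n
    unfolding A_def by (rule c0_finite[OF f]) simp
  define X where "X = (\<lambda>n t. \<Sum>s\<in>A n. f s * dirac s t)"
  have X: "X n t = (if t \<in> A n then f t else 0)" for n t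
    using finA[of n] by (simp add: X_def dirac_def if_distrib[of "(*) _"] cong: if_cong)
  have "(\<lambda>n. linf_norm (\<lambda>t. X n t - f t)) \<longlonglongrightarrow> 0"
  proof (rule linf_norm_tendsto_0)
    show "(\<lambda>n. 1 / real (Suc n)) \<longlonglongrightarrow> 0"
      using LIMSEQ_inverse_real_of_nat by (simp add: inverse_eq_divide)
    show "cmod (X n t - f t) \<le> 1 / real (Suc n)" for n t
      unfolding X by (auto simp: A_def)
  qed
  moreover have "X n \<in> E" for n
    unfolding X_def by (rule finsum[OF finA])
  ultimately show "f \<in> E"
    using closed f unfolding norm_closed_def c0_def by blast
qed

end

theorem theorem2p8:
  fixes E :: "('s::semigroup_mult \<Rightarrow> complex) set"
  assumes "finitely_left_divisible TYPE('s)"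
    and "cancellative TYPE('s)"
    and "finitely_generated TYPE('s)"
    and "hopf_algebra_predual E"
  shows "E = c0"
proof -
  interpret hopf_predual E
    by unfold_locales (rule assms(4))
  show ?thesis
    using subset_c0[OF assms(1,3)] c0_subset by blast
qed

end
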